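(* Let $\mu$ be a real number with $1/2<\mu<1$. Then the inclusion $\operatorname{Allow}(T_\mu)\subseteq\operatorname{Allow}(T_1)$ holds and is strict, i.e. $\operatorname{Allow}(T_\mu)\subsetneq\operatorname{Allow}(T_1)$.
   Context: For $0<\mu\le 1$, the symmetric tent map of height $\mu$ is $T_\mu:[0,1]\to[0,1]$, $T_\mu(x)=2\mu x$ if $0\le x\le 1/2$ and $T_\mu(x)=2\mu(1-x)$ if $1/2<x\le 1$. For a map $f:[0,1]\to[0,1]$, $f^k$ denotes the $k$-fold iterate ($f^0$ the identity). For $n\ge 1$ and $x\in[0,1]$ such that $x,f(x),\dots,f^{n-1}(x)$ are pairwise distinct, $\operatorname{Pat}(x,f,n)$ is the permutation $\pi=\pi_1\pi_2\cdots\pi_n$ of $\{1,\dots,n\}$ (one-line notation) whose entries are in the same relative order as $x,f(x),\dots,f^{n-1}(x)$, i.e. $\pi_i<\pi_j$ if and only if $f^{i-1}(x)<f^{j-1}(x)$. $\operatorname{Allow}_n(f)$ is the set of all permutations of $\{1,\dots,n\}$ of the form $\operatorname{Pat}(x,f,n)$ for some $x\in[0,1]$, and $\operatorname{Allow}(f)=\bigcup_{n\ge1}\operatorname{Allow}_n(f)$. *)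

theory Defs
  imports "HOL-Analysis.Analysis" "HOL-Combinatorics.Combinatorics"
begin

text \<open>The formula is total on the reals; only its restriction to \<open>[0,1]\<close>, which for
  \<open>0 < \<mu> \<le> 1\<close> is mapped into itself, is relevant.\<close>

definition tent :: "real \<Rightarrow> real \<Rightarrow> real" where
  "tent \<mu> x = (if x \<le> 1/2 then 2 * \<mu> * x else 2 * \<mu> * (1 - x))"

text \<open>Permutations of \<open>{1..n}\<close> are lists in one-line notation, indexed from \<open>0\<close>: the entry
  \<open>\<pi>\<^sub>i\<close> is \<open>\<pi> ! (i - 1)\<close>. Unlike functions with \<open>permutes\<close>, lists keep permutations of
  different lengths distinct, which matters for the union over \<open>n\<close> below.\<close>

definition is_pattern :: "real \<Rightarrow> (real \<Rightarrow> real) \<Rightarrow> nat \<Rightarrow> nat list \<Rightarrow> bool" where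
  "is_pattern x f n \<pi> \<longleftrightarrow> \<pi> \<in> permutations_of_set {1..n} \<and>
     (\<forall>i<n. \<forall>j<n. \<pi> ! i < \<pi> ! j \<longleftrightarrow> (f ^^ i) x < (f ^^ j) x)"

definition Pat :: "real \<Rightarrow> (real \<Rightarrow> real) \<Rightarrow> nat \<Rightarrow> nat list" where
  "Pat x f n = (THE \<pi>. is_pattern x f n \<pi>)"

definition Allow_n :: "nat \<Rightarrow> (real \<Rightarrow> real) \<Rightarrow> nat list set" where
  "Allow_n n f = {Pat x f n | x. x \<in> {0..1} \<and> inj_on (\<lambda>i. (f ^^ i) x) {..<n}}"

definition Allow :: "(real \<Rightarrow> real) \<Rightarrow> nat list set" where
  "Allow f = (\<Union>n\<in>{1..}. Allow_n n f)"

lemma tent_in_unit: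
  assumes "0 < \<mu>" "\<mu> \<le> 1" "x \<in> {0..1}"
  shows "tent \<mu> x \<in> {0..1}"
proof (cases "x \<le> 1/2")
  case True
  have "\<mu> * x \<le> 1 * (1/2)" using assms True by (intro mult_mono) auto
  then show ?thesis using assms True by (auto simp: tent_def)
next
  case False
  have "\<mu> * (1 - x) \<le> 1 * (1/2)" using assms False by (intro mult_mono) auto
  then show ?thesis using assms False by (auto simp: tent_def)
qed

lemma is_pattern_nth:
  assumes "is_pattern x f n \<pi>" "i < n"
  shows "\<pi> ! i = card {j. j < n \<and> (f ^^ j) x \<le> (f ^^ i) x}"
proof -
  have \<pi>: "set \<pi> = {1..n}" "distinct \<pi>"
    using assms(1) by (auto simp: is_pattern_def permutations_of_set_def)
  then have len: "length \<pi> = n" using distinct_card[of \<pi>] by simp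
  have mem: "\<pi> ! i \<in> {1..n}" using \<pi>(1) len assms(2) nth_mem[of i \<pi>] by auto
  have eq: "{j. j < n \<and> (f ^^ j) x \<le> (f ^^ i) x} = {j. j < n \<and> \<pi> ! j \<le> \<pi> ! i}"
    using assms unfolding is_pattern_def by (auto simp: not_less[symmetric])
  have "bij_betw ((!) \<pi>) {j. j < n \<and> \<pi> ! j \<le> \<pi> ! i} {1..\<pi> ! i}"
    unfolding bij_betw_def
  proof
    show "inj_on ((!) \<pi>) {j. j < n \<and> \<pi> ! j \<le> \<pi> ! i}"
      using \<pi>(2) len by (auto simp: inj_on_def nth_eq_iff_index_eq)
    have "k \<in> (!) \<pi> ` {j. j < n \<and> \<pi> ! j \<le> \<pi> ! i}" if "k \<in> {1..\<pi> ! i}" for k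
    proof -
      have "k \<in> set \<pi>" using that mem \<pi>(1) by auto
      then obtain j where "j < n" "\<pi> ! j = k" using len by (auto simp: in_set_conv_nth)
      then show ?thesis using that by force
    qed
    moreover have "\<pi> ! j \<ge> 1" if "j < n" for j
      using that \<pi>(1) len nth_mem[of j \<pi>] by auto
    ultimately show "(!) \<pi> ` {j. j < n \<and> \<pi> ! j \<le> \<pi> ! i} = {1..\<pi> ! i}" by auto
  qed
  then show ?thesis unfolding eq using bij_betw_same_card by force
qed

text \<open>The description in \<open>Pat\<close> is proper: the pattern exists and is unique.\<close>

lemma ex1_is_pattern:
  assumes inj: "inj_on (\<lambda>i. (f ^^ i) x) {..<n}"
  shows "\<exists>!\<pi>. is_pattern x f n \<pi>"
proof -
  define S where "S i = {j. j < n \<and> (f ^^ j) x \<le> (f ^^ i) x}" for i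
  define \<pi> where "\<pi> = map (\<lambda>i. card (S i)) [0..<n]"
  have fin: "finite (S i)" for i by (simp add: S_def)
  have less: "card (S i) < card (S j)" if "j < n" "(f ^^ i) x < (f ^^ j) x" for i j
  proof (rule psubset_card_mono[OF fin])
    have "j \<in> S j" "j \<notin> S i" "S i \<subseteq> S j" using that by (auto simp: S_def)
    then show "S i \<subset> S j" by auto
  qed
  have iff: "card (S i) < card (S j) \<longleftrightarrow> (f ^^ i) x < (f ^^ j) x" if "i < n" "j < n" for i j
  proof
    assume *: "card (S i) < card (S j)"
    show "(f ^^ i) x < (f ^^ j) x"
    proof (rule ccontr)
      assume "\<not> ?thesis"
      then have "(f ^^ j) x < (f ^^ i) x \<or> (f ^^ j) x = (f ^^ i) x" by auto
      then have "card (S j) \<le> card (S i)"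
        using less[of i j] that by (auto simp: S_def intro: less_imp_le)
      with * show False by simp
    qed
  qed (use less that in auto)
  have injc: "inj_on (\<lambda>i. card (S i)) {0..<n}"
  proof (rule inj_onI)
    fix i j assume ij: "i \<in> {0..<n}" "j \<in> {0..<n}" "card (S i) = card (S j)"
    then have "(f ^^ i) x = (f ^^ j) x" using less[of i j] less[of j i] by force
    with inj ij show "i = j" by (auto dest: inj_onD)
  qed
  have "(\<lambda>i. card (S i)) ` {0..<n} = {1..n}"
  proof (rule card_subset_eq)
    have "S i \<subseteq> {..<n}" for i by (auto simp: S_def)
    then have "card (S i) \<le> n" for i using card_mono[of "{..<n}" "S i"] by simp
    moreover have "card (S i) \<ge> 1" if "i < n" for i
    proof -
      have "i \<in> S i" using that by (auto simp: S_def)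
      then show ?thesis using fin[of i] by (auto simp: Suc_le_eq card_gt_0_iff)
    qed
    ultimately show "(\<lambda>i. card (S i)) ` {0..<n} \<subseteq> {1..n}" by auto
    show "card ((\<lambda>i. card (S i)) ` {0..<n}) = card {1..n}"
      using card_image[OF injc] by simp
  qed simp
  then have "is_pattern x f n \<pi>"
    using injc iff by (auto simp: is_pattern_def permutations_of_set_def \<pi>_def distinct_map)
  moreover have "\<rho> = \<pi>" if "is_pattern x f n \<rho>" for \<rho>
  proof (rule nth_equalityI)
    have "set \<rho> = {1..n}" "distinct \<rho>"
      using that by (auto simp: is_pattern_def permutations_of_set_def)
    then show len: "length \<rho> = length \<pi>" using distinct_card[of \<rho>] by (simp add: \<pi>_def)
    show "\<rho> ! i = \<pi> ! i" if "i < length \<rho>" for i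
      using is_pattern_nth[OF \<open>is_pattern x f n \<rho>\<close>, of i] that len by (simp add: \<pi>_def S_def)
  qed
  ultimately show ?thesis by blast
qed

lemma Pat_is_pattern:
  assumes "inj_on (\<lambda>i. (f ^^ i) x) {..<n}"
  shows "is_pattern x f n (Pat x f n)"
  unfolding Pat_def using ex1_is_pattern[OF assms] by (rule theI')

end

theory Submission
  imports Defs
begin

text \<open>For \<open>1/2 < \<mu> < 1\<close> let \<open>h\<close> send \<open>x\<close> to the point whose itinerary under \<open>T\<^sub>1\<close> (with respect to the
  two halves of the unit interval) is the itinerary of \<open>x\<close> under \<open>T\<^sub>\<mu>\<close>. Then \<open>h \<circ> T\<^sub>\<mu> = T\<^sub>1 \<circ> h\<close>, and \<open>h\<close>
  is monotone. It is injective: \<open>T\<^sub>\<mu>\<close> is expanding, so distinct points have distinct itineraries, and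
  two itineraries of the same point under \<open>T\<^sub>1\<close> must eventually be that of \<open>1\<close>, which is not in
  the image of \<open>T\<^sub>\<mu>\<close>. Hence \<open>h\<close> preserves patterns.

  For strictness, take the pattern of an orbit \<open>x\<^sub>0, \<dots>, x\<^sub>m\<close> of \<open>T\<^sub>1\<close> with \<open>x\<^sub>0\<close> just below \<open>1/2\<close>, so that
  \<open>x\<^sub>1\<close> is near \<open>1\<close>, \<open>x\<^sub>2\<close> near \<open>0\<close>, and \<open>x\<^sub>2 < x\<^sub>3 < \<dots> < x\<^sub>m < x\<^sub>1\<close>. For an orbit \<open>z\<close> of \<open>T\<^sub>\<mu>\<close> with this
  pattern, \<open>z\<^sub>1 \<le> \<mu>\<close> keeps \<open>z\<^sub>2\<close> away from \<open>0\<close>, while the increasing run forces \<open>z\<^sub>2, \<dots>, z\<^sub>m\<^sub>-\<^sub>2 \<le> 1/2\<close> and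
  so grows geometrically with ratio \<open>2 * \<mu> > 1\<close>; its length is therefore bounded.\<close>

section \<open>Construction of the monotone semiconjugacy \<open>tent_lift\<close>\<close>

text \<open>\<open>y / 2\<close> and \<open>1 - y / 2\<close> are the two inverse branches of
  \<open>tent 1\<close>; the side of 1/2 on which each iterate under \<open>tent \<mu>\<close> lies
  selects the branch.\<close>

primrec lift_approx :: "real \<Rightarrow> nat \<Rightarrow> real \<Rightarrow> real" where
  "lift_approx \<mu> 0 x = x"
| "lift_approx \<mu> (Suc n) x =
     (if x \<le> 1/2 then lift_approx \<mu> n (tent \<mu> x) / 2 else 1 - lift_approx \<mu> n (tent \<mu> x) / 2)"

definition tent_lift :: "real \<Rightarrow> real \<Rightarrow> real" where
  "tent_lift \<mu> x = lim (\<lambda>n. lift_approx \<mu> n x)"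

lemma funpow_tent_in_unit:
  assumes "0 < \<mu>" "\<mu> \<le> 1" "x \<in> {0..1}"
  shows "(tent \<mu> ^^ n) x \<in> {0..1}"
  by (induction n) (use assms tent_in_unit in auto)

lemma tent_le:
  assumes "0 < \<mu>"
  shows "tent \<mu> x \<le> \<mu>"
  using assms by (auto simp: tent_def)

lemma lift_approx_in_unit:
  assumes "0 < \<mu>" "\<mu> \<le> 1" "x \<in> {0..1}"
  shows "lift_approx \<mu> n x \<in> {0..1}"
  using assms(3)
proof (induction n arbitrary: x)
  case (Suc n)
  then show ?case using Suc.IH[OF tent_in_unit[OF assms(1,2) Suc.prems]] by auto
qed simp

text \<open>Where \<open>tent \<mu>\<close> reverses the order, so does the branch
  \<open>1 - y / 2\<close>, and the reversals cancel; for points on different sides, 1/2 separates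
  the values.\<close>

lemma lift_approx_mono:
  assumes \<mu>: "0 < \<mu>" "\<mu> \<le> 1"
  shows "x \<in> {0..1} \<Longrightarrow> y \<in> {0..1} \<Longrightarrow> x \<le> y \<Longrightarrow> lift_approx \<mu> n x \<le> lift_approx \<mu> n y"
proof (induction n arbitrary: x y)
  case (Suc n)
  have t: "tent \<mu> x \<in> {0..1}" "tent \<mu> y \<in> {0..1}"
    using tent_in_unit[OF \<mu>] Suc.prems by blast+
  consider "y \<le> 1/2" | "x \<le> 1/2" "y > 1/2" | "x > 1/2" by linarith
  then show ?case
  proof cases
    case 1
    then have "tent \<mu> x \<le> tent \<mu> y" using Suc.prems \<mu> by (auto simp: tent_def)
    then show ?thesis using 1 Suc.prems Suc.IH[OF t] by auto
  next
    case 2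
    then show ?thesis using lift_approx_in_unit[OF \<mu> t(1), of n] lift_approx_in_unit[OF \<mu> t(2), of n]
      by auto
  next
    case 3
    then have "tent \<mu> y \<le> tent \<mu> x" using Suc.prems \<mu> by (auto simp: tent_def)
    then show ?thesis using 3 Suc.prems Suc.IH[OF t(2,1)] by auto
  qed
qed simp

text \<open>Both inverse branches halve distances, which makes the approximations Cauchy.\<close>

lemma lift_approx_diff:
  assumes \<mu>: "0 < \<mu>" "\<mu> \<le> 1"
  shows "x \<in> {0..1} \<Longrightarrow> \<bar>lift_approx \<mu> (n + m) x - lift_approx \<mu> n x\<bar> \<le> (1/2) ^ n"
proof (induction n arbitrary: x)
  case 0
  then show ?case using lift_approx_in_unit[OF \<mu> 0, of m] by auto
next
  case (Suc n)
  have "\<bar>lift_approx \<mu> (n + m) (tent \<mu> x) - lift_approx \<mu> n (tent \<mu> x)\<bar> \<le> (1/2) ^ n"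
    using Suc.IH tent_in_unit[OF \<mu> Suc.prems] by blast
  then show ?case
    by (auto simp: diff_divide_distrib[symmetric] abs_minus_commute)
qed

lemma lift_approx_tendsto:
  assumes \<mu>: "0 < \<mu>" "\<mu> \<le> 1" and x: "x \<in> {0..1}"
  shows "(\<lambda>n. lift_approx \<mu> n x) \<longlonglongrightarrow> tent_lift \<mu> x"
proof -
  have "Cauchy (\<lambda>n. lift_approx \<mu> n x)"
  proof (rule CauchyI')
    fix e :: real assume "0 < e"
    then obtain N where N: "(1/2 :: real) ^ N < e"
      using real_arch_pow_inv[of e "1/2"] by auto
    have "dist (lift_approx \<mu> n x) (lift_approx \<mu> m x) < e" if "N \<le> n" "n < m" for n m
    proof -
      have "(1/2 :: real) ^ n \<le> (1/2) ^ N" using that by (intro power_decreasing) auto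
      moreover have "dist (lift_approx \<mu> n x) (lift_approx \<mu> m x) \<le> (1/2) ^ n"
        using lift_approx_diff[OF \<mu> x, of n "m - n"] that by (simp add: dist_real_def abs_minus_commute)
      ultimately show ?thesis using N by linarith
    qed
    then show "\<exists>M. \<forall>m\<ge>M. \<forall>n>m. dist (lift_approx \<mu> m x) (lift_approx \<mu> n x) < e" by blast
  qed
  then show ?thesis
    unfolding tent_lift_def by (simp add: Cauchy_convergent_iff convergent_LIMSEQ_iff)
qed

lemma tent_lift_in_unit:
  assumes "0 < \<mu>" "\<mu> \<le> 1" "x \<in> {0..1}"
  shows "tent_lift \<mu> x \<in> {0..1}"
  using LIMSEQ_le_const[OF lift_approx_tendsto[OF assms], of 0]
    LIMSEQ_le_const2[OF lift_approx_tendsto[OF assms], of 1] lift_approx_in_unit[OF assms]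
  by auto

lemma tent_lift_mono:
  assumes "0 < \<mu>" "\<mu> \<le> 1" "x \<in> {0..1}" "y \<in> {0..1}" "x \<le> y"
  shows "tent_lift \<mu> x \<le> tent_lift \<mu> y"
  using LIMSEQ_le[OF lift_approx_tendsto lift_approx_tendsto] lift_approx_mono assms by metis

lemma tent_lift_eq:
  assumes \<mu>: "0 < \<mu>" "\<mu> \<le> 1" and x: "x \<in> {0..1}"
  shows "tent_lift \<mu> x =
    (if x \<le> 1/2 then tent_lift \<mu> (tent \<mu> x) / 2 else 1 - tent_lift \<mu> (tent \<mu> x) / 2)"
proof (rule LIMSEQ_unique)
  show "(\<lambda>n. lift_approx \<mu> (Suc n) x) \<longlonglongrightarrow> tent_lift \<mu> x"
    using lift_approx_tendsto[OF assms] by (rule LIMSEQ_Suc)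
  have "(\<lambda>n. lift_approx \<mu> n (tent \<mu> x)) \<longlonglongrightarrow> tent_lift \<mu> (tent \<mu> x)"
    using lift_approx_tendsto[OF \<mu> tent_in_unit[OF assms]] .
  then show "(\<lambda>n. lift_approx \<mu> (Suc n) x) \<longlonglongrightarrow>
      (if x \<le> 1/2 then tent_lift \<mu> (tent \<mu> x) / 2 else 1 - tent_lift \<mu> (tent \<mu> x) / 2)"
    by (auto intro!: tendsto_intros)
qed

text \<open>\<open>tent 1\<close> undoes either inverse branch; at their common value 1/2 both of
  its formulas give 1.\<close>

lemma tent_lift_semiconj:
  assumes \<mu>: "0 < \<mu>" "\<mu> \<le> 1" and x: "x \<in> {0..1}"
  shows "tent 1 (tent_lift \<mu> x) = tent_lift \<mu> (tent \<mu> x)"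
  using tent_lift_in_unit[OF \<mu> tent_in_unit[OF assms]]
  by (auto simp: tent_lift_eq[OF assms] tent_def[of 1])

lemma funpow_tent_lift:
  assumes "0 < \<mu>" "\<mu> \<le> 1" "x \<in> {0..1}"
  shows "(tent 1 ^^ n) (tent_lift \<mu> x) = tent_lift \<mu> ((tent \<mu> ^^ n) x)"
  by (induction n) (use tent_lift_semiconj[OF assms(1,2)] funpow_tent_in_unit[OF assms] in auto)

section \<open>Injectivity of the lift by expansion\<close>

lemma geometric_bounded_imp_le_0:
  fixes a c d :: real
  assumes "1 < a" "\<And>n. a ^ n * d \<le> c"
  shows "d \<le> 0"
proof (rule ccontr)
  assume d: "\<not> d \<le> 0"
  obtain n where "c / d < a ^ n" using real_arch_pow[OF assms(1)] by blast
  then show False using assms(2)[of n] d by (simp add: field_simps)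
qed

text \<open>The right branch has values at least 1/2, so a zero value keeps the whole orbit in the
  left half, where each step multiplies by \<open>2 * \<mu>\<close>.\<close>

lemma tent_lift_eq_0:
  assumes \<mu>: "1/2 < \<mu>" "\<mu> \<le> 1" and x: "x \<in> {0..1}" and "tent_lift \<mu> x = 0"
  shows "x = 0"
proof -
  have \<mu>0: "0 < \<mu>" using \<mu> by simp
  have step: "w \<le> 1/2 \<and> tent_lift \<mu> (tent \<mu> w) = 0"
    if "w \<in> {0..1}" "tent_lift \<mu> w = 0" for w
    using that tent_lift_eq[OF \<mu>0 \<mu>(2) that(1)]
      tent_lift_in_unit[OF \<mu>0 \<mu>(2) tent_in_unit[OF \<mu>0 \<mu>(2) that(1)]]
    by (auto split: if_splits)
  have unit: "(tent \<mu> ^^ n) x \<in> {0..1}" for n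
    using funpow_tent_in_unit[OF \<mu>0 \<mu>(2) x] .
  have zero: "tent_lift \<mu> ((tent \<mu> ^^ n) x) = 0" for n
    by (induction n) (use assms(4) step unit in auto)
  have "(tent \<mu> ^^ n) x = (2 * \<mu>) ^ n * x" for n
  proof (induction n)
    case (Suc n)
    have "(tent \<mu> ^^ n) x \<le> 1/2" using step[OF unit zero] by blast
    then show ?case using Suc by (simp add: tent_def)
  qed simp
  then have "(2 * \<mu>) ^ n * x \<le> 1" for n using unit[of n] by simp
  then have "x \<le> 0" by (rule geometric_bounded_imp_le_0[rotated]) (use \<mu> in simp)
  then show ?thesis using x by simp
qed

text \<open>The value 1 needs the right branch with \<open>tent \<mu> x\<close> lifted to 0, hence
  \<open>x = 1\<close>, which lies outside the range of \<open>tent \<mu>\<close>.\<close>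

lemma tent_lift_neq_1:
  assumes \<mu>: "1/2 < \<mu>" "\<mu> < 1" and x: "x \<in> {0..\<mu>}"
  shows "tent_lift \<mu> x \<noteq> 1"
proof
  assume eq: "tent_lift \<mu> x = 1"
  have \<mu>': "0 < \<mu>" "\<mu> \<le> 1" and x': "x \<in> {0..1}" using \<mu> x by auto
  have t: "tent \<mu> x \<in> {0..1}" using tent_in_unit[OF \<mu>' x'] .
  have "x > 1/2 \<and> tent_lift \<mu> (tent \<mu> x) = 0"
    using eq tent_lift_eq[OF \<mu>' x'] tent_lift_in_unit[OF \<mu>' t] by (auto split: if_splits)
  then have "x > 1/2" "tent \<mu> x = 0"
    using tent_lift_eq_0[OF \<mu>(1) \<mu>'(2) t] by auto
  then show False using x \<mu> by (auto simp: tent_def)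
qed

text \<open>Equal lifts stay equal along the orbits, which keeps corresponding points on the same
  side of 1/2; their distance then grows exactly by the factor \<open>2 * \<mu>\<close>.\<close>

lemma tent_lift_inj:
  assumes \<mu>: "1/2 < \<mu>" "\<mu> < 1" and x: "x \<in> {0..1}" and y: "y \<in> {0..1}"
    and eq: "tent_lift \<mu> x = tent_lift \<mu> y"
  shows "x = y"
proof -
  have \<mu>': "0 < \<mu>" "\<mu> \<le> 1" using \<mu> by auto
  have same_side: "u \<le> 1/2 \<longleftrightarrow> v \<le> 1/2"
    if u: "u \<in> {0..1}" and v: "v \<in> {0..1}" and uv: "tent_lift \<mu> u = tent_lift \<mu> v" for u v
  proof -
    have False if "a \<in> {0..1}" "b \<in> {0..1}" "tent_lift \<mu> a = tent_lift \<mu> b" "a \<le> 1/2" "b > 1/2"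
      for a b
    proof -
      have t: "tent \<mu> a \<in> {0..1}" "tent \<mu> b \<in> {0..1}" using tent_in_unit[OF \<mu>'] that by blast+
      \<comment> \<open>The left branch is at most 1/2 and the right one at least 1/2, so both
        values equal 1/2.\<close>
      have "tent_lift \<mu> (tent \<mu> a) = 1"
        using that tent_lift_eq[OF \<mu>' that(1)] tent_lift_eq[OF \<mu>' that(2)]
          tent_lift_in_unit[OF \<mu>' t(1)] tent_lift_in_unit[OF \<mu>' t(2)] by auto
      then show False using tent_lift_neq_1[OF \<mu>, of "tent \<mu> a"] t tent_le[OF \<mu>'(1)] by auto
    qed
    then show ?thesis using that by (metis not_le)
  qed
  have unit: "(tent \<mu> ^^ n) x \<in> {0..1}" "(tent \<mu> ^^ n) y \<in> {0..1}" for n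
    using funpow_tent_in_unit[OF \<mu>'] x y by blast+
  have eqn: "tent_lift \<mu> ((tent \<mu> ^^ n) x) = tent_lift \<mu> ((tent \<mu> ^^ n) y)" for n
    using funpow_tent_lift[OF \<mu>' x, of n] funpow_tent_lift[OF \<mu>' y, of n] eq by simp
  have "\<bar>(tent \<mu> ^^ n) x - (tent \<mu> ^^ n) y\<bar> = (2 * \<mu>) ^ n * \<bar>x - y\<bar>" for n
  proof (induction n)
    case (Suc n)
    define u v where "u = (tent \<mu> ^^ n) x" and "v = (tent \<mu> ^^ n) y"
    have "u \<le> 1/2 \<longleftrightarrow> v \<le> 1/2"
      unfolding u_def v_def by (rule same_side[OF unit eqn])
    then have "tent \<mu> u - tent \<mu> v = 2 * \<mu> * (u - v) \<or> tent \<mu> u - tent \<mu> v = 2 * \<mu> * (v - u)"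
      by (auto simp: tent_def algebra_simps)
    then have "\<bar>tent \<mu> u - tent \<mu> v\<bar> = 2 * \<mu> * \<bar>u - v\<bar>"
      using \<mu>' by (auto simp: abs_mult abs_minus_commute)
    then show ?case using Suc by (simp add: u_def v_def)
  qed simp
  moreover have "\<bar>(tent \<mu> ^^ n) x - (tent \<mu> ^^ n) y\<bar> \<le> 1" for n
    using unit[of n] by auto
  ultimately have "(2 * \<mu>) ^ n * \<bar>x - y\<bar> \<le> 1" for n by metis
  then have "\<bar>x - y\<bar> \<le> 0" by (rule geometric_bounded_imp_le_0[rotated]) (use \<mu> in simp)
  then show ?thesis by simp
qed

lemma tent_lift_less_iff:
  assumes \<mu>: "1/2 < \<mu>" "\<mu> < 1" and x: "x \<in> {0..1}" and y: "y \<in> {0..1}"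
  shows "tent_lift \<mu> x < tent_lift \<mu> y \<longleftrightarrow> x < y"
  using tent_lift_mono[of \<mu> x y] tent_lift_mono[of \<mu> y x] tent_lift_inj[OF \<mu> x y] assms
  by (cases x y rule: linorder_cases) (auto simp: order.strict_iff_order)

section \<open>Inclusion of the allowed patterns\<close>

lemma Allow_tent_subset:
  assumes \<mu>: "1/2 < \<mu>" "\<mu> < 1"
  shows "Allow (tent \<mu>) \<subseteq> Allow (tent 1)"
proof
  fix \<pi> assume "\<pi> \<in> Allow (tent \<mu>)"
  then obtain n x where n: "n \<ge> 1" and x: "x \<in> {0..1}"
    and inj: "inj_on (\<lambda>i. (tent \<mu> ^^ i) x) {..<n}" and \<pi>: "\<pi> = Pat x (tent \<mu>) n"
    by (auto simp: Allow_def Allow_n_def)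
  have \<mu>': "0 < \<mu>" "\<mu> \<le> 1" using \<mu> by auto
  let ?y = "tent_lift \<mu> x"
  note unit = funpow_tent_in_unit[OF \<mu>' x]
  have injy: "inj_on (\<lambda>i. (tent 1 ^^ i) ?y) {..<n}"
    using inj tent_lift_inj[OF \<mu> unit unit]
    by (auto simp: inj_on_def funpow_tent_lift[OF \<mu>' x])
  \<comment> \<open>Strict monotonicity makes the comparisons along both orbits the same.\<close>
  have "is_pattern ?y (tent 1) n \<pi>"
    using Pat_is_pattern[OF inj]
    unfolding \<pi> is_pattern_def funpow_tent_lift[OF \<mu>' x] tent_lift_less_iff[OF \<mu> unit unit] .
  then have "\<pi> = Pat ?y (tent 1) n"
    using ex1_is_pattern[OF injy] Pat_is_pattern[OF injy] by blast
  then have "\<pi> \<in> Allow_n n (tent 1)"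
    using injy tent_lift_in_unit[OF \<mu>' x] by (auto simp: Allow_n_def)
  then show "\<pi> \<in> Allow (tent 1)" using n by (auto simp: Allow_def)
qed

section \<open>Strictness through long increasing runs\<close>

lemma is_pattern_length:
  assumes "is_pattern x f n \<pi>"
  shows "length \<pi> = n"
proof -
  have "set \<pi> = {1..n}" "distinct \<pi>"
    using assms by (auto simp: is_pattern_def permutations_of_set_def)
  then show ?thesis using distinct_card[of \<pi>] by simp
qed

text \<open>The right branch is decreasing: if \<open>z\<close> and \<open>tent \<mu> z\<close> both
  lie there, an increase is followed by a decrease.\<close>

lemma tent_increasing_run:
  assumes "0 < \<mu>" "z < tent \<mu> z" "tent \<mu> z < tent \<mu> (tent \<mu> z)"
  shows "z \<le> 1/2"
proof (rule ccontr)
  assume "\<not> z \<le> 1/2"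
  then have "tent \<mu> (tent \<mu> z) = 2 * \<mu> * (1 - tent \<mu> z)" "tent \<mu> z = 2 * \<mu> * (1 - z)"
    using assms(2) by (auto simp: tent_def)
  then show False using assms mult_strict_left_mono[of "1 - tent \<mu> z" "1 - z" "2 * \<mu>"] by simp
qed

lemma tent_long_run_bound:
  assumes \<mu>: "1/2 < \<mu>" "\<mu> \<le> 1" and z: "z \<in> {0..1}"
    and drop: "(tent \<mu> ^^ 2) z < tent \<mu> z"
    and run: "\<And>j. j \<le> k \<Longrightarrow> (tent \<mu> ^^ (j + 2)) z < (tent \<mu> ^^ (j + 3)) z"
  shows "(2 * \<mu>) ^ k * (2 * \<mu> * (1 - \<mu>)) \<le> 1"
proof -
  have \<mu>0: "0 < \<mu>" using \<mu> by simp
  let ?z = "\<lambda>j. (tent \<mu> ^^ (j + 2)) z"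
  have Suc_z: "?z (Suc j) = tent \<mu> (?z j)" for j by simp
  have geo: "j \<le> k \<Longrightarrow> ?z j = (2 * \<mu>) ^ j * ?z 0" for j
  proof (induction j)
    case (Suc j)
    \<comment> \<open>Two successive increases are needed, so the left half is certain only for
      indices below \<open>k\<close>, just enough to reach \<open>?z k\<close>.\<close>
    have "?z j < tent \<mu> (?z j)" "tent \<mu> (?z j) < tent \<mu> (tent \<mu> (?z j))"
      using run[of j] run[of "Suc j"] Suc.prems by (simp_all add: eval_nat_numeral)
    then have "?z j \<le> 1/2" by (rule tent_increasing_run[OF \<mu>0])
    then have "tent \<mu> (?z j) = 2 * \<mu> * ?z j" unfolding tent_def[of \<mu> "?z j"] by (rule if_P)
    then show ?case using Suc unfolding Suc_z by simp
  qed simp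
  have z2: "?z 0 = tent \<mu> (tent \<mu> z)" by (simp add: eval_nat_numeral)
  have t: "tent \<mu> z \<in> {0..1}" using tent_in_unit[OF \<mu>0 \<mu>(2) z] .
  \<comment> \<open>In the left half \<open>tent \<mu>\<close> lowers no point, so the drop must
    start in the right half.\<close>
  have "tent \<mu> z > 1/2"
  proof (rule ccontr)
    assume "\<not> tent \<mu> z > 1/2"
    then have "tent \<mu> (tent \<mu> z) = 2 * \<mu> * tent \<mu> z" by (simp add: tent_def[of \<mu> "tent \<mu> z"])
    moreover have "1 * tent \<mu> z \<le> 2 * \<mu> * tent \<mu> z"
      using \<mu> t by (intro mult_right_mono) auto
    ultimately show False using drop by (simp add: eval_nat_numeral)
  qed
  then have "?z 0 = 2 * \<mu> * (1 - tent \<mu> z)" by (simp add: z2 tent_def[of \<mu> "tent \<mu> z"])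
  then have "2 * \<mu> * (1 - \<mu>) \<le> ?z 0" using tent_le[OF \<mu>0, of z] \<mu>0 by simp
  then have "(2 * \<mu>) ^ k * (2 * \<mu> * (1 - \<mu>)) \<le> ?z k"
    unfolding geo[OF order_refl] using \<mu>0 by (intro mult_left_mono) auto
  also have "?z k \<le> 1" using funpow_tent_in_unit[OF \<mu>0 \<mu>(2) z, of "k + 2"] by simp
  finally show ?thesis .
qed

text \<open>With \<open>e = 1 / 2 ^ (k + 4)\<close> the orbit is \<open>1/2 - e\<close>,
  \<open>1 - 2 * e\<close>, \<open>4 * e\<close>, \<open>8 * e\<close> and so on, reaching the
  turning point 1/2 exactly at its last index \<open>k + 3\<close>.\<close>

lemma full_tent_long_run:
  fixes k :: nat
  defines "x \<equiv> 1/2 - 1 / 2 ^ (k + 4) :: real"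
  shows "x \<in> {0..1}"
    and "inj_on (\<lambda>i. (tent 1 ^^ i) x) {..<k + 4}"
    and "(tent 1 ^^ 2) x < tent 1 x"
    and "\<And>j. j \<le> k \<Longrightarrow> (tent 1 ^^ (j + 2)) x < (tent 1 ^^ (j + 3)) x"
proof -
  let ?t = "\<lambda>i. (tent 1 ^^ i) x"
  define e :: real where "e = 1 / 2 ^ (k + 4)"
  have xe: "x = 1/2 - e" by (simp add: x_def e_def)
  have "(2::real) ^ (k + 4) \<ge> 16" by (simp add: power_add)
  then have e: "0 < e" "e \<le> 1/16" by (auto simp: e_def field_simps)
  then show "x \<in> {0..1}" by (simp add: xe)
  have t1: "tent 1 x = 1 - 2 * e" using e by (simp add: xe tent_def)
  have ek: "2 ^ (k + 3) * e = 1/2" by (simp add: e_def power_add)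
  have pow: "2 ^ (j + 2) * e \<le> 1/4" if "j \<le> k" for j
  proof -
    have "(2::real) ^ (j + 2) * e \<le> 2 ^ (k + 2) * e"
      using that e by (intro mult_right_mono power_increasing) auto
    then show ?thesis using ek by (simp add: power_add)
  qed
  have run: "j \<le> k + 1 \<Longrightarrow> ?t (j + 2) = 2 ^ (j + 2) * e" for j
  proof (induction j)
    case 0
    then show ?case using e t1 by (simp add: eval_nat_numeral tent_def[of 1 "1 - 2 * e"])
  next
    case (Suc j)
    then have "?t (j + 2) \<le> 1/4" "?t (j + 2) = 2 ^ (j + 2) * e" using pow[of j] by auto
    then have "tent 1 (?t (j + 2)) = 2 * 1 * ?t (j + 2)"
      unfolding tent_def[of 1 "?t (j + 2)"] by (intro if_P) linarith
    then show ?case using \<open>?t (j + 2) = 2 ^ (j + 2) * e\<close> by simp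
  qed
  have half: "?t (j + 2) \<le> 1/2" if "j \<le> k + 1" for j
    using run[OF that] pow[of j] ek that by (cases "j = k + 1") (auto simp: eval_nat_numeral)
  show "?t 2 < tent 1 x" using half[of 0] t1 e by (simp add: eval_nat_numeral)
  show "?t (j + 2) < ?t (j + 3)" if "j \<le> k" for j
    using run[of j] run[of "j + 1"] that e by (simp add: eval_nat_numeral)
  have inj2: "?t (i + 2) \<noteq> ?t (j + 2)" if "i < j" "j \<le> k + 1" for i j
    using run[of i] run[of j] that e by simp
  \<comment> \<open>The run stays at most 1/4 except for its last point 1/2, while \<open>x\<close>
    lies in between.\<close>
  have ne0: "?t (j + 2) \<noteq> x" if "j \<le> k + 1" for j
    using run[OF that] pow[of j] ek that e xe by (cases "j = k + 1") (auto simp: eval_nat_numeral)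
  have ne: "?t i \<noteq> ?t j" if ij: "i < j" "j < k + 4" for i j
  proof -
    consider "i = 0" "j = 1" | j' where "i = 0" "j = j' + 2" | j' where "i = 1" "j = j' + 2"
      | i' j' where "i = i' + 2" "j = j' + 2"
    proof -
      have "i = 0 \<or> i = 1 \<or> i = (i - 2) + 2" "j = 1 \<or> j = (j - 2) + 2" using ij by linarith+
      then show thesis using that ij(1) by (metis less_irrefl less_one)
    qed
    then show ?thesis
    proof cases
      case 1
      then show ?thesis using t1 xe e by simp
    next
      case 2
      then show ?thesis using ne0[of j'] ij by simp
    next
      case 3
      then show ?thesis using half[of j'] ij t1 e by auto
    next
      case 4
      then show ?thesis using inj2[of i' j'] ij by simp
    qed
  qed
  show "inj_on ?t {..<k + 4}"
    by (rule inj_onI) (metis ne lessThan_iff linorder_neqE_nat)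
qed

theorem mainTheorem2:
  fixes \<mu> :: real
  assumes "1/2 < \<mu>" and "\<mu> < 1"
  shows "Allow (tent \<mu>) \<subset> Allow (tent 1)"
proof -
  have pos: "0 < 2 * \<mu> * (1 - \<mu>)" using assms by simp
  \<comment> \<open>The bound of \<open>tent_long_run_bound\<close> fails for some \<open>k\<close>,
    since its constant factor is positive.\<close>
  then have "\<not> (\<forall>k. (2 * \<mu>) ^ k * (2 * \<mu> * (1 - \<mu>)) \<le> 1)"
    using geometric_bounded_imp_le_0[of "2 * \<mu>" "2 * \<mu> * (1 - \<mu>)" 1] assms(1) by force
  then obtain k where k: "(2 * \<mu>) ^ k * (2 * \<mu> * (1 - \<mu>)) > 1" by (auto simp: not_le)
  define x :: real where "x = 1/2 - 1 / 2 ^ (k + 4)"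
  note x = full_tent_long_run[where k = k, folded x_def]
  let ?\<pi> = "Pat x (tent 1) (k + 4)"
  have "?\<pi> \<in> Allow_n (k + 4) (tent 1)" using x(1,2) by (auto simp: Allow_n_def)
  then have "?\<pi> \<in> Allow (tent 1)" by (auto simp: Allow_def)
  moreover have "?\<pi> \<notin> Allow (tent \<mu>)"
  proof
    assume "?\<pi> \<in> Allow (tent \<mu>)"
    then obtain n z where z: "z \<in> {0..1}" "inj_on (\<lambda>i. (tent \<mu> ^^ i) z) {..<n}"
      "?\<pi> = Pat z (tent \<mu>) n"
      by (auto simp: Allow_def Allow_n_def)
    note px = Pat_is_pattern[OF x(2)]
    have pz: "is_pattern z (tent \<mu>) n ?\<pi>" using Pat_is_pattern[OF z(2)] z(3) by simp
    \<comment> \<open>\<open>Allow\<close> forgets the index \<open>n\<close>; the length of the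
      list recovers it.\<close>
    have n: "n = k + 4" using is_pattern_length[OF px] is_pattern_length[OF pz] by simp
    \<comment> \<open>One list orders both orbits. The run uses indices up to \<open>k + 3\<close>,
      whence the pattern length \<open>k + 4\<close>.\<close>
    have transfer: "(tent \<mu> ^^ i) z < (tent \<mu> ^^ j) z"
      if "(tent 1 ^^ i) x < (tent 1 ^^ j) x" "i < k + 4" "j < k + 4" for i j
      using px pz that unfolding n is_pattern_def by blast
    have "(2 * \<mu>) ^ k * (2 * \<mu> * (1 - \<mu>)) \<le> 1"
    proof (rule tent_long_run_bound)
      show "(tent \<mu> ^^ 2) z < tent \<mu> z" using transfer[of 2 1] x(3) by simp
      show "(tent \<mu> ^^ (j + 2)) z < (tent \<mu> ^^ (j + 3)) z" if "j \<le> k" for j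
        using transfer[OF x(4)[OF that]] that by simp
    qed (use assms z(1) in auto)
    then show False using k by simp
  qed
  ultimately show ?thesis using Allow_tent_subset[OF assms] by blast
qed

end
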